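(* Let $\alpha$ be a Liouville number, let $\mathcal F_\alpha$ be the foliation of the torus $\mathbb T^2=\mathbb R^2/\mathbb Z^2$ by the orbits of the vector field $X=\partial_x+\alpha\,\partial_y$. There exists a family $(f_t)_{t\in\mathbb R}$ of (complex-valued) functions on $\mathbb T^2$ such that: (i) $(f_t)$ is a smooth family of smooth functions, i.e. $(t,x,y)\mapsto f_t(x,y)$ is smooth on $\mathbb R\times\mathbb T^2$; (ii) for each $t\in\mathbb R$ there is a smooth function $g_t$ on $\mathbb T^2$ with $f_t=Xg_t$; (iii) there is no smooth, nor even continuous, family $(g_t)_{t\in\mathbb R}$ of smooth functions on $\mathbb T^2$ with $f_t=Xg_t$ for all $t\in\mathbb R$. Equivalently, $(f_t\,\overline{dx})_{t\in\mathbb R}$ is a smooth family of exact foliated $1$-forms on $(\mathbb T^2,\mathcal F_\alpha)$ which is not the coboundary of any smooth, nor even continuous, family of functions.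
   Context: A Liouville number is an irrational number $\alpha$ such that for every integer $p\ge 1$ there exist relatively prime integers $m,n$ with $n>1$ and $|\alpha-\frac mn|<\frac1{|n|^p}$. $x,y$ are the standard coordinates on $\mathbb T^2$. A foliated $1$-form on $(\mathbb T^2,\mathcal F_\alpha)$ is a class of smooth $1$-forms on $\mathbb T^2$ modulo those vanishing along the leaves of $\mathcal F_\alpha$; each one can be written $f\,\overline{dx}$ with $f\in C^\infty(\mathbb T^2)$, where $\overline{dx}$ is the class of $dx$. It is exact (i.e. equal to the class of $dg$ for some $g\in C^\infty(\mathbb T^2)$) if and only if $f=Xg$. A continuous family $(g_t)$ means that $(t,x,y)\mapsto g_t(x,y)$ is continuous on $\mathbb R\times\mathbb T^2$. *)

theory Defs
  imports "HOL-Analysis.Analysis"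
begin

definition Liouville :: "real \<Rightarrow> bool" where
  "Liouville \<alpha> \<longleftrightarrow> \<alpha> \<notin> \<rat> \<and>
     (\<forall>p::nat. p \<ge> 1 \<longrightarrow>
        (\<exists>m n :: int. coprime m n \<and> n > 1 \<and>
           \<bar>\<alpha> - real_of_int m / real_of_int n\<bar> < 1 / \<bar>real_of_int n\<bar> ^ p))"

(* On a finite-dimensional domain, f is C^(k+1) iff f is Frechet differentiable
   and each directional derivative x |-> Df(x) v is C^k. *)
primrec Ck :: "nat \<Rightarrow> ('a::euclidean_space \<Rightarrow> 'b::real_normed_vector) \<Rightarrow> bool" where
  "Ck 0 f \<longleftrightarrow> continuous_on UNIV f"
| "Ck (Suc k) f \<longleftrightarrow> (\<forall>x. f differentiable (at x)) \<and>
     (\<forall>v. Ck k (\<lambda>x. frechet_derivative f (at x) v))"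

definition smooth :: "('a::euclidean_space \<Rightarrow> 'b::real_normed_vector) \<Rightarrow> bool" where
  "smooth f \<longleftrightarrow> (\<forall>k. Ck k f)"

(* Functions on the torus R^2 / Z^2 are identified with their lifts to R^2, that is, with
   the functions of (x, y) that are 1-periodic in x and in y.  The projection R^2 -> R^2 / Z^2
   is an open map and a local diffeomorphism, so that continuity and smoothness on the torus,
   and on R times the torus, are those of the lifts. *)
definition on_torus :: "(real \<times> real \<Rightarrow> 'b) \<Rightarrow> bool" where
  "on_torus g \<longleftrightarrow> (\<forall>x y. g (x + 1, y) = g (x, y) \<and> g (x, y + 1) = g (x, y))"

definition smooth_torus :: "(real \<times> real \<Rightarrow> complex) \<Rightarrow> bool" where
  "smooth_torus g \<longleftrightarrow> on_torus g \<and> smooth g"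

definition smooth_family :: "(real \<Rightarrow> real \<times> real \<Rightarrow> complex) \<Rightarrow> bool" where
  "smooth_family g \<longleftrightarrow> (\<forall>t. on_torus (g t)) \<and> smooth (\<lambda>(t, p). g t p)"

definition continuous_family :: "(real \<Rightarrow> real \<times> real \<Rightarrow> complex) \<Rightarrow> bool" where
  "continuous_family g \<longleftrightarrow> (\<forall>t. on_torus (g t)) \<and> continuous_on UNIV (\<lambda>(t, p). g t p)"

(* The differential is only meaningful for differentiable g; it is applied below to smooth
   functions only.  The same holds for the operator X. *)
definition dif :: "(real \<times> real \<Rightarrow> complex) \<Rightarrow> real \<times> real \<Rightarrow> real \<times> real \<Rightarrow> complex" where
  "dif g p v = frechet_derivative g (at p) v"

definition X :: "real \<Rightarrow> (real \<times> real \<Rightarrow> complex) \<Rightarrow> real \<times> real \<Rightarrow> complex" where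
  "X \<alpha> g p = dif g p (1, 0) + of_real \<alpha> * dif g p (0, 1)"

(* A complex-valued 1-form sends a point p and a tangent vector v to \<omega> p v; the tangent
   spaces of the torus are all identified with R^2. *)
type_synonym form = "real \<times> real \<Rightarrow> real \<times> real \<Rightarrow> complex"

definition smooth_form :: "form \<Rightarrow> bool" where
  "smooth_form \<omega> \<longleftrightarrow> (\<forall>p. linear (\<omega> p)) \<and> (\<forall>v. smooth_torus (\<lambda>p. \<omega> p v))"

definition orbit :: "real \<Rightarrow> real \<times> real \<Rightarrow> real \<Rightarrow> real \<times> real" where
  "orbit \<alpha> p s = p + s *\<^sub>R (1, \<alpha>)"

(* The leaves of the foliation are the (images in the torus of the) orbits of X, and the
   velocity of an orbit is the constant vector (1, \<alpha>). *)
definition vanishes_along_leaves :: "real \<Rightarrow> form \<Rightarrow> bool" where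
  "vanishes_along_leaves \<alpha> \<omega> \<longleftrightarrow> (\<forall>p s. \<omega> (orbit \<alpha> p s) (1, \<alpha>) = 0)"

definition foliated_class :: "real \<Rightarrow> form \<Rightarrow> form set" where
  "foliated_class \<alpha> \<omega> =
     {\<eta>. smooth_form \<eta> \<and> vanishes_along_leaves \<alpha> (\<lambda>p v. \<eta> p v - \<omega> p v)}"

definition times_dx :: "(real \<times> real \<Rightarrow> complex) \<Rightarrow> form" where
  "times_dx f p v = f p * of_real (fst v)"

definition exact_foliated :: "real \<Rightarrow> form set \<Rightarrow> bool" where
  "exact_foliated \<alpha> \<Omega> \<longleftrightarrow> (\<exists>g. smooth_torus g \<and> \<Omega> = foliated_class \<alpha> (dif g))"

(* A family of foliated forms is smooth if it is represented by a smooth family of forms. *)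
definition smooth_foliated_family :: "real \<Rightarrow> (real \<Rightarrow> form set) \<Rightarrow> bool" where
  "smooth_foliated_family \<alpha> \<Omega> \<longleftrightarrow>
     (\<exists>\<omega>. (\<forall>t. smooth_form (\<omega> t)) \<and> (\<forall>v. smooth_family (\<lambda>t p. \<omega> t p v)) \<and>
          (\<forall>t. \<Omega> t = foliated_class \<alpha> (\<omega> t)))"

end

theory Submission imports Defs begin

text \<open>
  Choose integers m_j, n_j with n_j > j and gap_j = n_j \<alpha> - m_j nonzero but smaller than n_j^(-j), and let
  e_j(x, y) = exp (2 \<pi> i (n_j y - m_j x)), so that X e_j = 2 \<pi> i gap_j e_j.  Put
  \<phi>_j(t) = n_j t exp (- n_j t^2) and g_t = \<Sum>j. \<phi>_j(t) e_j.  For fixed t the coefficients \<phi>_j(t) decay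
  rapidly in n_j, but \<phi>_j(1 / n_j) does not tend to 0.  In f_t = X g_t the factor gap_j beats every
  power of n_j, uniformly in t, which makes f jointly smooth.  Any other solution differs from g_t by
  a constant on the orbit of the origin; and along that orbit, for t \<ge> 0,
  Re (g_t(0) - g_t(s, \<alpha> s)) = \<Sum>j. \<phi>_j(t) (1 - cos (2 \<pi> gap_j s))
  has nonnegative terms, so that a single term, at t = 1 / n_k and s = 1 / (2 gap_k), shows that the
  oscillation is at least 2 / e for arbitrarily small t, although f_0 = 0.
\<close>

section \<open>Termwise differentiation of series and calculus of C^k maps\<close>

lemma has_derivative_suminf:
  fixes f :: "nat \<Rightarrow> 'a::real_normed_vector \<Rightarrow> 'b::banach"
  assumes deriv: "\<And>i x. (f i has_derivative f' i x) (at x)"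
    and bound: "\<And>i x h. norm (f' i x h) \<le> M i * norm h"
    and M: "summable M" and f: "\<And>x. summable (\<lambda>i. f i x)"
  shows "((\<lambda>x. \<Sum>i. f i x) has_derivative (\<lambda>h. \<Sum>i. f' i x h)) (at x)"
proof -
  have sf': "summable (\<lambda>i. f' i x h)" for x h
    by (rule summable_comparison_test'[OF summable_mult2[OF M, of "norm h"], of 0]) (use bound in auto)
  \<comment> \<open>This is the M-test at the level of derivatives: the tail of the sum of
    \<open>M\<close> bounds the error of the partial sums as linear maps, uniformly in x, which is
    the uniformity that \<open>has_derivative_series\<close> asks for.\<close>
  have ev: "\<forall>\<^sub>F n in sequentially. \<forall>x\<in>UNIV. \<forall>h. norm ((\<Sum>i<n. f' i x h) - (\<Sum>i. f' i x h)) \<le> e * norm h"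
    if "e > 0" for e
  proof -
    obtain N where N: "\<And>n. n \<ge> N \<Longrightarrow> norm (\<Sum>i. M (i + n)) < e"
      using suminf_exist_split[OF \<open>e > 0\<close> M] by blast
    have "norm ((\<Sum>i<n. f' i x h) - (\<Sum>i. f' i x h)) \<le> e * norm h" if "n \<ge> N" for n x h
    proof -
      have sM: "summable (\<lambda>i. M (i + n) * norm h)"
        using M by (intro summable_mult2 summable_ignore_initial_segment)
      have "norm ((\<Sum>i<n. f' i x h) - (\<Sum>i. f' i x h)) = norm (\<Sum>i. f' (i + n) x h)"
        using suminf_split_initial_segment[OF sf', of x h n] by simp
      also have "\<dots> \<le> (\<Sum>i. M (i + n) * norm h)"
        by (rule norm_suminf_le) (use bound sM in auto)
      also have "\<dots> = (\<Sum>i. M (i + n)) * norm h"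
        using M by (intro suminf_mult2[symmetric] summable_ignore_initial_segment)
      also have "\<dots> \<le> e * norm h"
        using N[OF that] by (intro mult_right_mono) auto
      finally show ?thesis .
    qed
    then show ?thesis unfolding eventually_sequentially by blast
  qed
  obtain g where g: "\<And>x. (\<lambda>i. f i x) sums g x" "\<And>x. (g has_derivative (\<lambda>h. \<Sum>i. f' i x h)) (at x)"
    using has_derivative_series[OF convex_UNIV, of f f' "\<lambda>x h. \<Sum>i. f' i x h" 0 "\<Sum>i. f i 0"]
      deriv ev f by (auto simp: summable_sums) blast
  have "g = (\<lambda>x. \<Sum>i. f i x)"
    using g(1) by (auto simp: sums_iff)
  then show ?thesis using g(2) by simp
qed

lemma has_frechet_derivative:
  "f differentiable (at x) \<Longrightarrow> (f has_derivative frechet_derivative f (at x)) (at x)"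
  by (simp add: frechet_derivative_works[symmetric])

text \<open>A single term of a series with nonnegative terms is at most the sum. The inequality lets
  the Gaussian factors below absorb any power of t or of n_j.\<close>

lemma power_over_fact_le_exp:
  fixes x :: real
  assumes "x \<ge> 0"
  shows "x ^ k / fact k \<le> exp x"
proof -
  have "(\<lambda>i. x ^ i / fact i) sums exp x"
    using exp_converges[of x] by (simp add: divide_inverse mult.commute)
  then show ?thesis
    using sum_le_suminf[of "\<lambda>i. x ^ i / fact i" "{k}"] assms by (auto simp: sums_iff)
qed

lemma Ck_add:
  "Ck k f \<Longrightarrow> Ck k g \<Longrightarrow> Ck k (\<lambda>x. f x + g x)"
proof (induction k arbitrary: f g)
  case (Suc k)
  have d: "((\<lambda>x. f x + g x) has_derivative
      (\<lambda>v. frechet_derivative f (at x) v + frechet_derivative g (at x) v)) (at x)" for x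
    using Suc.prems by (intro has_derivative_add has_frechet_derivative) auto
  then have "frechet_derivative (\<lambda>x. f x + g x) (at x) =
      (\<lambda>v. frechet_derivative f (at x) v + frechet_derivative g (at x) v)" for x
    by (metis frechet_derivative_at)
  with d Suc show ?case by (auto simp: differentiable_def)
qed (simp add: continuous_on_add)

lemma Ck_bounded_linear:
  assumes "bounded_linear L"
  shows "Ck k f \<Longrightarrow> Ck k (\<lambda>x. L (f x))"
proof (induction k arbitrary: f)
  case 0
  then show ?case using assms by (simp add: bounded_linear.continuous_on)
next
  case (Suc k)
  have d: "((\<lambda>x. L (f x)) has_derivative (\<lambda>v. L (frechet_derivative f (at x) v))) (at x)" for x
    using Suc.prems by (intro bounded_linear.has_derivative[OF assms] has_frechet_derivative) auto
  then have "frechet_derivative (\<lambda>x. L (f x)) (at x) = (\<lambda>v. L (frechet_derivative f (at x) v))" for x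
    by (metis frechet_derivative_at)
  with d Suc show ?case by (auto simp: differentiable_def)
qed

text \<open>Passes from joint smoothness of a family to smoothness of each member. The derivative of
  the slice in direction v is the slice of the derivative in direction (0, v), so the induction
  closes.\<close>

lemma Ck_slice:
  fixes f :: "'a::euclidean_space \<times> 'b::euclidean_space \<Rightarrow> 'c::real_normed_vector"
  shows "Ck k f \<Longrightarrow> Ck k (\<lambda>y. f (a, y))"
proof (induction k arbitrary: f)
  case 0
  have "continuous_on UNIV (f \<circ> Pair a)"
    using 0 by (intro continuous_on_compose continuous_intros) (auto intro: continuous_on_subset)
  then show ?case by (simp add: o_def)
next
  case (Suc k)
  have d: "((\<lambda>y. f (a, y)) has_derivative (\<lambda>v. frechet_derivative f (at (a, x)) (0, v))) (at x)" for x
  proof -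
    have "((\<lambda>y. (a, y)) has_derivative (\<lambda>v. (0, v))) (at x)"
      by (auto intro!: derivative_eq_intros)
    moreover have "(f has_derivative frechet_derivative f (at (a, x))) (at (a, x))"
      using Suc.prems by (intro has_frechet_derivative) auto
    ultimately show ?thesis by (rule has_derivative_compose)
  qed
  then have "frechet_derivative (\<lambda>y. f (a, y)) (at x) = (\<lambda>v. frechet_derivative f (at (a, x)) (0, v))" for x
    by (metis frechet_derivative_at)
  with d Suc.prems show ?case
    by (auto simp: differentiable_def intro!: Suc.IH[of "\<lambda>x. frechet_derivative f (at x) (0, _)"])
qed

lemma smooth_mult_const:
  fixes f :: "'a::euclidean_space \<Rightarrow> complex"
  shows "smooth f \<Longrightarrow> smooth (\<lambda>x. f x * a)"
  unfolding smooth_def using Ck_bounded_linear[OF bounded_linear_mult_left] by blast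

lemma smooth_differentiable: "smooth f \<Longrightarrow> f differentiable (at x)"
  unfolding smooth_def by (metis Ck.simps(2))

lemma smooth_continuous: "smooth f \<Longrightarrow> continuous_on UNIV f"
  unfolding smooth_def by (metis Ck.simps(1))

lemma smooth_family_torus: "smooth_family g \<Longrightarrow> smooth_torus (g t)"
  using Ck_slice[of _ "\<lambda>(t, p). g t p" t] by (auto simp: smooth_family_def smooth_torus_def smooth_def)

lemma smooth_family_continuous: "smooth_family g \<Longrightarrow> continuous_family g"
  by (simp add: smooth_family_def continuous_family_def smooth_continuous)

section \<open>Approximations of a Liouville number with large denominators\<close>

lemma Liouville_approximation:
  assumes "Liouville \<alpha>"
  obtains m n :: int where "n > int k" "real_of_int n * \<alpha> \<noteq> real_of_int m"
    "\<bar>real_of_int n * \<alpha> - real_of_int m\<bar> < 1 / real_of_int n ^ k"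
proof -
  have irr: "\<alpha> \<notin> \<rat>" using assms by (simp add: Liouville_def)
  have ne: "real_of_int n * \<alpha> \<noteq> real_of_int m" if "n > 0" for m n :: int
  proof
    assume "real_of_int n * \<alpha> = real_of_int m"
    then have "\<alpha> = real_of_int m / real_of_int n" using that by (simp add: field_simps)
    then show False using irr by auto
  qed
  \<comment> \<open>The Liouville condition only guarantees n > 1, so large n has to be forced. Here
    \<open>d n\<close> is the distance from n \<alpha> to the integers, positive by irrationality;
    an approximation closer than the least of the values d 1, ..., d k must have n > k. The inserted
    1 keeps \<open>S\<close> nonempty when k = 0.\<close>
  define d where "d n = \<bar>real_of_int n * \<alpha> - real_of_int (round (real_of_int n * \<alpha>))\<bar>" for n :: int
  define S where "S = insert 1 (d ` {1..int k})"
  have S: "finite S" "S \<noteq> {}" by (auto simp: S_def)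
  have "Min S > 0"
    using S ne by (subst Min_gr_iff) (auto simp: S_def d_def)
  then obtain q :: nat where q: "(1/2) ^ q < Min S"
    using real_arch_pow_inv[of "Min S" "1/2"] by auto
  \<comment> \<open>The exponent k gives the required estimate. The exponent q excludes small
    denominators, since n \<ge> 2 gives n^(-q) \<le> 2^(-q) < Min S. Multiplying the approximation
    by n costs one power, hence \<open>Suc p\<close> below.\<close>
  define p where "p = max k q"
  obtain m n :: int where n: "n > 1" and
    mn: "\<bar>\<alpha> - real_of_int m / real_of_int n\<bar> < 1 / \<bar>real_of_int n\<bar> ^ Suc p"
    using assms by (auto simp: Liouville_def dest!: spec[of _ "Suc p"])
  have "\<bar>real_of_int n * \<alpha> - real_of_int m\<bar> = real_of_int n * \<bar>\<alpha> - real_of_int m / real_of_int n\<bar>"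
  proof -
    have "real_of_int n * (\<alpha> - real_of_int m / real_of_int n) = real_of_int n * \<alpha> - real_of_int m"
      using n by (simp add: right_diff_distrib)
    then show ?thesis using n by (metis abs_mult abs_of_pos of_int_0_less_iff less_trans zero_less_one)
  qed
  also have "\<dots> < real_of_int n * (1 / \<bar>real_of_int n\<bar> ^ Suc p)"
    using mn n by (intro mult_strict_left_mono) auto
  also have "\<dots> = 1 / real_of_int n ^ p" using n by simp
  finally have lt: "\<bar>real_of_int n * \<alpha> - real_of_int m\<bar> < 1 / real_of_int n ^ p" .
  have pow: "1 / real_of_int n ^ p \<le> 1 / real_of_int n ^ i" if "i \<le> p" for i
    using n that by (intro divide_left_mono power_increasing) auto
  have "n > int k"
  proof (rule ccontr)
    assume "\<not> n > int k"
    then have "d n \<in> S" using n by (auto simp: S_def)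
    then have "Min S \<le> d n" using S by simp
    also have "\<dots> \<le> \<bar>real_of_int n * \<alpha> - real_of_int m\<bar>"
      unfolding d_def by (metis abs_minus_commute round_diff_minimal)
    also have "\<dots> < 1 / real_of_int n ^ q" using lt pow[of q] by (simp add: p_def)
    also have "\<dots> \<le> (1/2) ^ q" using n by (auto simp: power_one_over intro!: divide_left_mono power_mono)
    finally show False using q by simp
  qed
  with that[of n m] ne[of n m] n lt pow[of k] show thesis by (simp add: p_def)
qed

section \<open>Rapidly decaying coefficient sequences\<close>

locale small_denominators =
  fixes \<alpha> :: real and m n :: "nat \<Rightarrow> int"
  assumes n_gt: "n j > int j"
    and denominator_nonzero: "real_of_int (n j) * \<alpha> \<noteq> real_of_int (m j)"
    and denominator_small: "\<bar>real_of_int (n j) * \<alpha> - real_of_int (m j)\<bar> < 1 / real_of_int (n j) ^ j"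
begin

definition gap :: "nat \<Rightarrow> real" where "gap j = n j * \<alpha> - m j"

lemma n_ge: "real_of_int (n j) \<ge> 1 + real j"
  using n_gt[of j] by linarith

lemma n_ge_1: "real_of_int (n j) \<ge> 1"
  using n_ge[of j] by linarith

(* The series with rapidly decaying coefficients are closed under all directional derivatives,
   which multiply the coefficients by n or m; their smoothness thus follows by induction. *)
definition rapid :: "(nat \<Rightarrow> complex) \<Rightarrow> bool" where
  "rapid c \<longleftrightarrow> (\<forall>l. summable (\<lambda>j. norm (c j) * real_of_int (n j) ^ l))"

text \<open>Boundedness suffices: the bound for the exponent l + 2 leaves a factor n_j^(-2) \<le> (j
  + 1)^(-2), which is summable. An eventual bound is allowed because the estimate on the gaps takes
  effect only for j > l.\<close>

lemma rapidI:
  assumes "\<And>l. \<exists>C. \<forall>\<^sub>F j in sequentially. norm (c j) * real_of_int (n j) ^ l \<le> C"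
  shows "rapid c"
  unfolding rapid_def
proof
  fix l
  obtain C where C: "\<forall>\<^sub>F j in sequentially. norm (c j) * real_of_int (n j) ^ (l + 2) \<le> C"
    using assms by blast
  have "summable (\<lambda>j. C * inverse (real (Suc j) ^ 2))"
    using inverse_power_summable[of 2, where 'a=real]
    by (intro summable_mult) (subst summable_Suc_iff[where f = "\<lambda>j. inverse (real j ^ 2)"], simp)
  then show "summable (\<lambda>j. norm (c j) * real_of_int (n j) ^ l)"
  proof (rule summable_comparison_test_ev[rotated])
    show "\<forall>\<^sub>F j in sequentially. norm (norm (c j) * real_of_int (n j) ^ l) \<le> C * inverse (real (Suc j) ^ 2)"
      using C
    proof eventually_elim
      case (elim j)
      have "norm (c j) * real_of_int (n j) ^ l * real (Suc j) ^ 2 \<le> norm (c j) * real_of_int (n j) ^ l * real_of_int (n j) ^ 2"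
        using n_ge[of j] by (intro mult_left_mono power_mono) auto
      also have "\<dots> \<le> C" using elim by (simp add: power_add mult_ac power2_eq_square)
      finally show ?case using n_ge_1[of j] by (simp add: field_simps del: of_nat_Suc)
    qed
  qed
qed

lemma rapid_cmult: "rapid c \<Longrightarrow> rapid (\<lambda>j. a * c j)"
  by (auto simp: rapid_def norm_mult mult.assoc intro!: summable_mult)

lemma rapid_n: "rapid c \<Longrightarrow> rapid (\<lambda>j. of_int (n j) * c j)"
  unfolding rapid_def
proof
  fix l assume "\<forall>l. summable (\<lambda>j. norm (c j) * real_of_int (n j) ^ l)"
  then have "summable (\<lambda>j. norm (c j) * real_of_int (n j) ^ Suc l)" by blast
  moreover have "norm (of_int (n j) * c j) * real_of_int (n j) ^ l = norm (c j) * real_of_int (n j) ^ Suc l" for j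
    using n_ge_1[of j] by (simp add: norm_mult)
  ultimately show "summable (\<lambda>j. norm (of_int (n j) * c j) * real_of_int (n j) ^ l)" by (simp only:)
qed

lemma rapid_mono:
  assumes "rapid c" and le: "\<And>j. norm (d j) \<le> norm (c j)"
  shows "rapid d"
  unfolding rapid_def
proof
  fix l
  have "summable (\<lambda>j. norm (c j) * real_of_int (n j) ^ l)" using assms by (simp add: rapid_def)
  then show "summable (\<lambda>j. norm (d j) * real_of_int (n j) ^ l)"
  proof (rule summable_comparison_test'[where N = 0])
    fix j show "norm (norm (d j) * real_of_int (n j) ^ l) \<le> norm (c j) * real_of_int (n j) ^ l"
      using le[of j] n_ge_1[of j] by (auto simp: abs_mult power_abs intro!: mult_right_mono)
  qed
qed

text \<open>Derivatives in x bring down factors m_j, while \<open>rapid\<close> measures decay in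
  n_j. As m_j lies within 1 of n_j \<alpha>, these factors are controlled by n_j.\<close>

lemma m_le: "\<bar>real_of_int (m j)\<bar> \<le> (\<bar>\<alpha>\<bar> + 1) * real_of_int (n j)"
proof -
  have "1 / real_of_int (n j) ^ j \<le> 1" using n_ge_1[of j] by simp
  then have "\<bar>real_of_int (m j)\<bar> \<le> \<bar>real_of_int (n j) * \<alpha>\<bar> + 1"
    using denominator_small[of j] by linarith
  then show ?thesis using n_ge_1[of j] by (simp add: abs_mult algebra_simps)
qed

lemma rapid_m:
  assumes "rapid c"
  shows "rapid (\<lambda>j. of_int (m j) * c j)"
proof (rule rapid_mono)
  show "rapid (\<lambda>j. of_real (\<bar>\<alpha>\<bar> + 1) * (of_int (n j) * c j))"
    by (intro rapid_cmult rapid_n assms)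
  show "norm (of_int (m j) * c j) \<le> norm (complex_of_real (\<bar>\<alpha>\<bar> + 1) * (of_int (n j) * c j))" for j
  proof -
    have "\<bar>\<bar>\<alpha>\<bar> + 1\<bar> = \<bar>\<alpha>\<bar> + 1" "\<bar>real_of_int (n j)\<bar> = real_of_int (n j)"
      using n_ge_1[of j] by linarith+
    with mult_right_mono[OF m_le[of j], of "norm (c j)"] show ?thesis
      by (simp only: norm_mult norm_of_real norm_of_int of_int_abs mult.assoc norm_ge_zero)
  qed
qed

lemma rapid_summable: "rapid c \<Longrightarrow> summable (\<lambda>j. norm (c j))"
  unfolding rapid_def by (auto dest: spec[of _ 0])

section \<open>Fourier series weighted by Gaussians in t\<close>

definition mode :: "nat \<Rightarrow> real \<times> real \<times> real \<Rightarrow> complex" where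
  "mode j z = (case z of (t, x, y) \<Rightarrow>
     exp (of_real (- (of_int (n j) * t\<^sup>2)) + \<i> * of_real (2 * pi * (of_int (n j) * y - of_int (m j) * x))))"

text \<open>Here \<open>mode j\<close> is the Fourier mode e_j times a Gaussian in t, with pure e_j
  at t = 0. The power t^b is carried along because differentiating the Gaussian in t produces a
  factor t; with it the class of such series is closed under differentiation in all three
  variables.\<close>

definition series :: "(nat \<Rightarrow> complex) \<Rightarrow> nat \<Rightarrow> real \<times> real \<times> real \<Rightarrow> complex" where
  "series c b z = (\<Sum>j. c j * of_real (fst z ^ b) * mode j z)"

lemma norm_mode: "norm (mode j (t, x, y)) = exp (- (of_int (n j) * t\<^sup>2))"
  by (simp add: mode_def)

lemma norm_monomial_mode: "norm (of_real (fst z ^ b) * mode j z) \<le> 1 + fact b"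
proof -
  obtain t x y where z: "z = (t, x, y)" by (cases z)
  (* since n_j \<ge> 1, it suffices to bound |t|^b by a multiple of exp (t^2) *)
  have "\<bar>t\<bar> ^ b \<le> 1 + (t\<^sup>2) ^ b"
  proof (cases "\<bar>t\<bar> \<le> 1")
    case True
    then have "\<bar>t\<bar> ^ b \<le> 1" by (intro power_le_one) auto
    moreover have "(t\<^sup>2) ^ b \<ge> 0" by simp
    ultimately show ?thesis by linarith
  next
    case False
    then have "\<bar>t\<bar> ^ b \<le> (\<bar>t\<bar> ^ b) ^ 2" by (intro self_le_power) auto
    also have "\<dots> = (t\<^sup>2) ^ b" by (subst power2_abs[of t, symmetric], simp only: power_mult[symmetric] mult.commute)
    finally show ?thesis by simp
  qed
  also have "(t\<^sup>2) ^ b \<le> fact b * exp (t\<^sup>2)"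
    using power_over_fact_le_exp[of "t\<^sup>2" b] by (simp add: field_simps)
  also have "1 + fact b * exp (t\<^sup>2) \<le> (1 + fact b) * exp (t\<^sup>2)"
    by (simp add: algebra_simps)
  also have "\<dots> \<le> (1 + fact b) * exp (of_int (n j) * t\<^sup>2)"
    using mult_right_mono[OF n_ge_1[of j], of "t\<^sup>2"] by (intro mult_left_mono) auto
  finally show ?thesis
    by (simp add: z norm_mult norm_mode norm_power power_abs exp_minus field_simps)
qed


lemma series_summable:
  assumes "rapid c"
  shows "summable (\<lambda>j. c j * of_real (fst z ^ b) * mode j z)"
proof (rule summable_comparison_test'[where N = 0])
  show "summable (\<lambda>j. norm (c j) * (1 + fact b))"
    using rapid_summable[OF assms] by (rule summable_mult2)
  show "norm (c j * of_real (fst z ^ b) * mode j z) \<le> norm (c j) * (1 + fact b)" for j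
    using mult_left_mono[OF norm_monomial_mode[of z b j], of "norm (c j)"]
    by (simp add: norm_mult mult.assoc)
qed

lemma mode_has_derivative:
  "(mode j has_derivative (\<lambda>h. mode j z * (of_real (-2 * of_int (n j) * fst z * fst h) +
      2 * pi * \<i> * of_real (of_int (n j) * snd (snd h) - of_int (m j) * fst (snd h))))) (at z)"
proof -
  define L where "L z = complex_of_real (- (of_int (n j) * (fst z)\<^sup>2)) +
      \<i> * of_real (2 * pi * (of_int (n j) * snd (snd z) - of_int (m j) * fst (snd z)))" for z :: "real \<times> real \<times> real"
  have "(L has_derivative (\<lambda>h. of_real (-2 * of_int (n j) * fst z * fst h) +
      2 * pi * \<i> * of_real (of_int (n j) * snd (snd h) - of_int (m j) * fst (snd h)))) (at z)"
    unfolding L_def by (auto intro!: derivative_eq_intros simp: algebra_simps fun_eq_iff)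
  then have "((\<lambda>z. exp (L z)) has_derivative (\<lambda>h. exp (L z) * (of_real (-2 * of_int (n j) * fst z * fst h) +
      2 * pi * \<i> * of_real (of_int (n j) * snd (snd h) - of_int (m j) * fst (snd h))))) (at z)"
    by (rule has_derivative_compose[OF _ DERIV_exp[unfolded has_field_derivative_def]])
  moreover have "mode j = (\<lambda>z. exp (L z))"
    by (auto simp: mode_def L_def fun_eq_iff)
  ultimately show ?thesis by simp
qed

text \<open>The four series come from differentiating, in this order, the power of t, the Gaussian,
  and the oscillating factor in y and in x. For b = 0 the truncated \<open>b - 1\<close> is
  harmless, since the coefficients of that series contain the factor b. The M-test applies because
  \<open>norm_monomial_mode\<close> is uniform in z and j.\<close>

lemma series_has_derivative:
  assumes c: "rapid c"
  shows "(series c b has_derivative (\<lambda>h.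
     series (\<lambda>j. of_real (b * fst h) * c j) (b - 1) z +
     series (\<lambda>j. of_real (-2 * fst h) * (of_int (n j) * c j)) (Suc b) z +
     series (\<lambda>j. 2 * pi * \<i> * of_real (snd (snd h)) * (of_int (n j) * c j)) b z +
     series (\<lambda>j. - 2 * pi * \<i> * of_real (fst (snd h)) * (of_int (m j) * c j)) b z)) (at z)"
    (is "(_ has_derivative ?D) _")
proof -
  define T where "T c b j z = c j * of_real (fst z ^ b) * mode j z"
    for c b j and z :: "real \<times> real \<times> real"
  define c1 where "c1 h j = of_real (b * fst h) * c j" for h :: "real \<times> real \<times> real" and j
  define c2 where "c2 h j = of_real (-2 * fst h) * (of_int (n j) * c j)"
    for h :: "real \<times> real \<times> real" and j
  define c3 where "c3 h j = 2 * pi * \<i> * of_real (snd (snd h)) * (of_int (n j) * c j)"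
    for h :: "real \<times> real \<times> real" and j
  define c4 where "c4 h j = - 2 * pi * \<i> * of_real (fst (snd h)) * (of_int (m j) * c j)"
    for h :: "real \<times> real \<times> real" and j
  note cs = c1_def c2_def c3_def c4_def
  have rap: "rapid (c1 h)" "rapid (c2 h)" "rapid (c3 h)" "rapid (c4 h)" for h
    unfolding cs by (intro rapid_cmult rapid_n rapid_m c)+
  have sumT: "summable (\<lambda>j. T c b j z)" if "rapid c" for c b z
    using series_summable[OF that] by (simp add: T_def)
  define D where "D j z h = T (c1 h) (b - 1) j z + T (c2 h) (Suc b) j z + T (c3 h) b j z + T (c4 h) b j z"
    for j z h
  \<comment> \<open>\<open>K\<close> is the sum of the constants for the four pieces. The pieces
    with \<open>c2\<close> and \<open>c3\<close> both carry the coefficients n_j c_j, so for them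
    \<open>K\<close> has to dominate the sum of two constants.\<close>
  define K where "K = real b * (1 + fact (b - 1)) + 2 * (1 + fact (Suc b)) + 2 * pi * (1 + fact b) +
     2 * pi * (1 + fact b)"
  define M where "M j = norm (c j) * K + norm (of_int (n j) * c j) * K + norm (of_int (m j) * c j) * K" for j
  have nonneg: "0 \<le> real b * (1 + fact (b - 1))" "0 \<le> 2 * (1 + fact (Suc b) :: real)" "0 \<le> 2 * pi * (1 + fact b)"
    by (intro mult_nonneg_nonneg add_nonneg_nonneg; simp)+
  have K: "real b * (1 + fact (b - 1)) \<le> K" "2 * (1 + fact (Suc b)) + 2 * pi * (1 + fact b) \<le> K"
      "2 * pi * (1 + fact b) \<le> K"
    using nonneg unfolding K_def by linarith+
  have fsth: "\<bar>fst h\<bar> \<le> norm h" "\<bar>fst (snd h)\<bar> \<le> norm h" "\<bar>snd (snd h)\<bar> \<le> norm h"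
    for h :: "real \<times> real \<times> real"
    using norm_fst_le[of "fst h" "snd h"] norm_snd_le[of "snd h" "fst h"]
      norm_fst_le[of "fst (snd h)" "snd (snd h)"] norm_snd_le[of "snd (snd h)" "fst (snd h)"]
    by simp_all
  \<comment> \<open>In each piece the scalar a depends linearly on the direction h; q bounds it
    relative to the norm of h, which yields the factor \<open>norm h\<close> required of a
    derivative bound.\<close>
  have normT: "norm (T (\<lambda>j. a * d j) b j z) \<le> norm (d j) * (q * (1 + fact b)) * norm h"
    if "norm a \<le> q * norm h" for a q d b j z and h :: "real \<times> real \<times> real"
  proof -
    have nn: "0 \<le> q * norm h" using that norm_ge_zero order_trans by blast
    have "norm (T (\<lambda>j. a * d j) b j z) = norm a * norm (d j) * norm (of_real (fst z ^ b) * mode j z)"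
      by (simp add: T_def norm_mult)
    also have "\<dots> \<le> (q * norm h) * norm (d j) * (1 + fact b)"
      by (intro mult_mono mult_nonneg_nonneg[OF nn] nn that order_refl norm_ge_zero norm_monomial_mode)
    finally show ?thesis by (simp add: mult_ac)
  qed
  have "((\<lambda>z. \<Sum>j. T c b j z) has_derivative (\<lambda>h. \<Sum>j. D j z h)) (at z)"
  proof (rule has_derivative_suminf[where M = M])
    show "((T c b j) has_derivative (D j z)) (at z)" for j z
    proof -
      have "((\<lambda>z. complex_of_real (fst z ^ b)) has_derivative
          (\<lambda>h. of_real (real b * fst h * fst z ^ (b - 1)))) (at z)"
        by (auto intro!: derivative_eq_intros)
      note has_derivative_mult_right[OF has_derivative_mult[OF this mode_has_derivative], of "c j" j]
      moreover have "(\<lambda>z. c j * (of_real (fst z ^ b) * mode j z)) = T c b j"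
        by (simp add: T_def fun_eq_iff mult.assoc)
      moreover have "c j * (of_real (fst z ^ b) * (mode j z * (of_real (-2 * of_int (n j) * fst z * fst h) +
            2 * pi * \<i> * of_real (of_int (n j) * snd (snd h) - of_int (m j) * fst (snd h)))) +
          of_real (real b * fst h * fst z ^ (b - 1)) * mode j z) = D j z h" for h
        by (simp add: T_def D_def cs algebra_simps)
      ultimately show ?thesis by simp
    qed
    show "summable M"
      unfolding M_def by (intro summable_add summable_mult2 rapid_summable rapid_n rapid_m c)
    show "summable (\<lambda>j. T c b j z)" for z using sumT c by simp
    show "norm (D j z h) \<le> M j * norm h" for j z h
    proof -
      have "norm (T (c1 h) (b - 1) j z) \<le> norm (c j) * (real b * (1 + fact (b - 1))) * norm h"
        unfolding cs using fsth[of h] by (intro normT) (simp add: norm_mult abs_mult mult_left_mono)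
      also have "\<dots> \<le> norm (c j) * K * norm h"
        using K by (intro mult_right_mono mult_left_mono) auto
      finally have 1: "norm (T (c1 h) (b - 1) j z) \<le> norm (c j) * K * norm h" .
      have 2: "norm (T (c2 h) (Suc b) j z) \<le> norm (of_int (n j) * c j) * (2 * (1 + fact (Suc b))) * norm h"
        unfolding cs using fsth[of h] by (intro normT) (simp add: norm_mult abs_mult)
      have 3: "norm (T (c3 h) b j z) \<le> norm (of_int (n j) * c j) * (2 * pi * (1 + fact b)) * norm h"
        unfolding cs using fsth[of h] by (intro normT) (simp add: norm_mult abs_mult)
      have "norm (of_int (n j) * c j) * (2 * (1 + fact (Suc b)) + 2 * pi * (1 + fact b)) * norm h
          \<le> norm (of_int (n j) * c j) * K * norm h"
        using K by (intro mult_right_mono mult_left_mono) auto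
      then have 23: "norm (of_int (n j) * c j) * (2 * (1 + fact (Suc b))) * norm h +
          norm (of_int (n j) * c j) * (2 * pi * (1 + fact b)) * norm h
          \<le> norm (of_int (n j) * c j) * K * norm h"
        by (simp only: distrib_left distrib_right)
      have "norm (T (c4 h) b j z) \<le> norm (of_int (m j) * c j) * (2 * pi * (1 + fact b)) * norm h"
        unfolding cs using fsth[of h] by (intro normT) (simp add: norm_mult abs_mult)
      also have "\<dots> \<le> norm (of_int (m j) * c j) * K * norm h"
        using K by (intro mult_right_mono mult_left_mono) auto
      finally have 4: "norm (T (c4 h) b j z) \<le> norm (of_int (m j) * c j) * K * norm h" .
      have "norm (D j z h) \<le> norm (T (c1 h) (b - 1) j z) + norm (T (c2 h) (Suc b) j z) +
          norm (T (c3 h) b j z) + norm (T (c4 h) b j z)"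
        unfolding D_def by (intro norm_triangle_le add_right_mono) (rule order_refl | assumption)+
      also have "\<dots> \<le> norm (c j) * K * norm h + norm (of_int (n j) * c j) * K * norm h +
          norm (of_int (m j) * c j) * K * norm h"
        using 1 2 3 23 4 by linarith
      finally show ?thesis by (simp only: M_def distrib_right)
    qed
  qed
  moreover have "(\<Sum>j. D j z h) = ?D h" for h
  proof -
    have sums: "(\<lambda>j. T c b j z) sums series c b z" if "rapid c" for c b
      using summable_sums[OF sumT[OF that]] by (simp add: T_def series_def)
    have "(\<lambda>j. D j z h) sums (series (c1 h) (b - 1) z + series (c2 h) (Suc b) z +
        series (c3 h) b z + series (c4 h) b z)"
      unfolding D_def by (intro sums_add sums rap)
    then show ?thesis
      unfolding cs[abs_def] by (rule sums_unique[symmetric])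
  qed
  moreover have "(\<lambda>z. \<Sum>j. T c b j z) = series c b"
    by (simp add: series_def T_def fun_eq_iff)
  ultimately show ?thesis by simp
qed

lemma series_smooth: "rapid c \<Longrightarrow> smooth (series c b)"
  unfolding smooth_def
proof
  fix k assume "rapid c"
  then show "Ck k (series c b)"
  proof (induction k arbitrary: c b)
    case 0
    have "continuous_on UNIV (series c b)"
      by (rule has_derivative_continuous_on, rule has_derivative_at_withinI, rule series_has_derivative[OF 0])
    then show ?case by simp
  next
    case (Suc k)
    note D = series_has_derivative[OF Suc.prems, of b]
    have "series c b differentiable (at z)" for z
      using D differentiable_def by blast
    then show ?case
      unfolding Ck.simps frechet_derivative_at[OF D, symmetric]
      by (intro conjI allI Ck_add Suc.IH rapid_cmult rapid_n rapid_m Suc.prems)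
  qed
qed

lemma mode_periodic:
  "mode j (t, x + 1, y) = mode j (t, x, y)" "mode j (t, x, y + 1) = mode j (t, x, y)"
proof -
  have "exp (\<i> * of_real (2 * pi * (of_int (n j) * y - of_int (m j) * (x + 1)))) = exp (\<i> * of_real (2 * pi * (of_int (n j) * y - of_int (m j) * x)))"
    by (subst exp_eq) (rule exI[of _ "- m j"], simp add: algebra_simps)
  then show "mode j (t, x + 1, y) = mode j (t, x, y)"
    by (simp only: mode_def prod.case exp_add)
  have "exp (\<i> * of_real (2 * pi * (of_int (n j) * (y + 1) - of_int (m j) * x))) = exp (\<i> * of_real (2 * pi * (of_int (n j) * y - of_int (m j) * x)))"
    by (subst exp_eq) (rule exI[of _ "n j"], simp add: algebra_simps)
  then show "mode j (t, x, y + 1) = mode j (t, x, y)"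
    by (simp only: mode_def prod.case exp_add)
qed

lemma series_family: "rapid c \<Longrightarrow> smooth_family (\<lambda>t p. series c b (t, p))"
proof -
  assume "rapid c"
  moreover have "(\<lambda>(t, p). series c b (t, p)) = series c b" by auto
  ultimately show ?thesis
    using series_smooth[of c b] by (simp add: smooth_family_def on_torus_def) (simp add: series_def mode_periodic)
qed

section \<open>The family of functions and its primitives for fixed t\<close>

definition bump :: "real \<Rightarrow> nat \<Rightarrow> complex" where
  "bump t j = of_real (of_int (n j) * t * exp (- (of_int (n j) * t\<^sup>2)))"

text \<open>The first argument of \<open>series\<close> is frozen at 0 to switch off the Gaussian of
  \<open>mode\<close>, because \<open>bump t\<close> already contains it. The result is the g_t of
  the overview.\<close>

definition primitive :: "real \<Rightarrow> real \<times> real \<Rightarrow> complex" where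
  "primitive t p = series (bump t) 0 (0, p)"

text \<open>This is the f_t of the overview. Its coefficients are free of t: the dependence on t
  lies entirely in t^1 and the Gaussian of \<open>mode\<close>, so joint smoothness in t and p is an
  instance of \<open>series_smooth\<close>.\<close>

definition source :: "real \<Rightarrow> real \<times> real \<Rightarrow> complex" where
  "source t p = series (\<lambda>j. 2 * pi * \<i> * of_real (gap j * of_int (n j))) 1 (t, p)"

lemma gap_nonzero: "gap j \<noteq> 0"
  using denominator_nonzero by (simp add: gap_def)

text \<open>The weight n_j^l and the factor n_j of the coefficient make n_j^(l + 1), which the bound
  n_j^(-j) on the gap cancels as soon as j \<ge> l + 1.\<close>

lemma rapid_source: "rapid (\<lambda>j. 2 * pi * \<i> * of_real (gap j * of_int (n j)))"
proof (rule rapidI, rule exI)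
  fix l
  show "\<forall>\<^sub>F j in sequentially. norm (2 * pi * \<i> * of_real (gap j * of_int (n j))) * real_of_int (n j) ^ l \<le> 2 * pi"
    using eventually_ge_at_top[of "Suc l"]
  proof eventually_elim
    case (elim j)
    have "\<bar>gap j\<bar> * real_of_int (n j) ^ Suc l \<le> \<bar>gap j\<bar> * real_of_int (n j) ^ j"
      using n_ge_1[of j] elim by (intro mult_left_mono power_increasing) auto
    also have "\<dots> \<le> 1"
      using denominator_small[of j] n_ge_1[of j] by (simp add: gap_def field_simps)
    finally show ?case using n_ge_1[of j] by (simp add: norm_mult abs_mult mult_ac)
  qed
qed

text \<open>For t \<noteq> 0 the Gaussian is at most (l + 1)! / (n_j t^2)^(l + 1), which beats
  n_j^(l + 1). The resulting constant blows up as t tends to 0, so the decay is obtained for each t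
  separately.\<close>

lemma rapid_bump: "rapid (bump t)"
proof (cases "t = 0")
  case True
  then show ?thesis by (simp add: rapid_def bump_def)
next
  case False
  show ?thesis
  proof (rule rapidI, intro exI always_eventually allI)
    fix l j
    have "(n j * t\<^sup>2) ^ Suc l \<le> fact (Suc l) * exp (n j * t\<^sup>2)"
      using power_over_fact_le_exp[of "n j * t\<^sup>2" "Suc l"] n_ge_1[of j] by (simp add: field_simps del: fact_Suc)
    then have "real_of_int (n j) ^ Suc l * exp (- (n j * t\<^sup>2)) \<le> fact (Suc l) / (t\<^sup>2) ^ Suc l"
      using False by (simp add: power_mult_distrib exp_minus field_simps del: fact_Suc power_Suc)
    then have "\<bar>t\<bar> * (real_of_int (n j) ^ Suc l * exp (- (n j * t\<^sup>2))) \<le> \<bar>t\<bar> * (fact (Suc l) / (t\<^sup>2) ^ Suc l)"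
      by (intro mult_left_mono) auto
    then show "norm (bump t j) * real_of_int (n j) ^ l \<le> \<bar>t\<bar> * (fact (Suc l) / (t\<^sup>2) ^ Suc l)"
      using n_ge_1[of j] by (simp add: bump_def norm_mult abs_mult mult_ac del: fact_Suc)
  qed
qed

lemma source_family: "smooth_family source"
  using series_family[OF rapid_source] by (simp add: source_def[abs_def])

lemma primitive_torus: "smooth_torus (primitive t)"
  using smooth_family_torus[OF series_family[OF rapid_bump, of t 0], of 0]
  by (simp add: primitive_def[abs_def])

end

section \<open>Differentiation along the leaves\<close>

lemma X_eq: "g differentiable (at p) \<Longrightarrow> X \<alpha> g p = frechet_derivative g (at p) (1, \<alpha>)"
proof -
  assume "g differentiable (at p)"
  then have "linear (frechet_derivative g (at p))" by (rule linear_frechet_derivative)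
  then have "frechet_derivative g (at p) ((1, 0) + \<alpha> *\<^sub>R (0, 1)) =
      frechet_derivative g (at p) (1, 0) + \<alpha> *\<^sub>R frechet_derivative g (at p) (0, 1)"
    by (metis linear_add linear_scale)
  then show ?thesis by (simp add: X_def dif_def scaleR_conv_of_real)
qed

text \<open>By the chain rule the derivative in s of a function at s (1, \<alpha>) is its image
  under X at that point, so the difference has zero derivative along the orbit of the
  origin.\<close>

lemma X_eq_imp_diff_constant:
  assumes g: "\<And>p. g differentiable (at p)" and h: "\<And>p. h differentiable (at p)"
    and eq: "X \<alpha> g = X \<alpha> h"
  shows "g (s *\<^sub>R (1, \<alpha>)) - h (s *\<^sub>R (1, \<alpha>)) = g 0 - h 0"
proof -
  define k where "k s = g (s *\<^sub>R (1, \<alpha>)) - h (s *\<^sub>R (1, \<alpha>))" for s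
  have along: "((\<lambda>s. f (s *\<^sub>R (1, \<alpha>))) has_derivative (\<lambda>v. v *\<^sub>R X \<alpha> f (s *\<^sub>R (1, \<alpha>)))) (at s)"
    if f: "\<And>p. f differentiable (at p)" for f :: "real \<times> real \<Rightarrow> complex" and s
  proof -
    have "((\<lambda>s. s *\<^sub>R (1, \<alpha>)) has_derivative (\<lambda>v. v *\<^sub>R (1, \<alpha>))) (at s)"
      by (auto intro!: derivative_eq_intros)
    then have "((\<lambda>s. f (s *\<^sub>R (1, \<alpha>))) has_derivative
        (\<lambda>v. frechet_derivative f (at (s *\<^sub>R (1, \<alpha>))) (v *\<^sub>R (1, \<alpha>)))) (at s)"
      using has_frechet_derivative[OF f] by (rule has_derivative_compose)
    then show ?thesis
      by (simp only: X_eq[OF f] linear_scale[OF linear_frechet_derivative[OF f]])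
  qed
  have "(k has_derivative (\<lambda>v. 0)) (at s)" for s
    using has_derivative_diff[OF along[OF g, of s] along[OF h, of s]] by (simp add: k_def[abs_def] eq)
  then obtain c where "\<And>s. k s = c"
    using has_derivative_zero_constant[OF convex_UNIV, of k] by auto
  then have "k s = k 0" by simp
  then show ?thesis by (simp add: k_def flip: zero_prod_def)
qed

section \<open>Periodicity and uniform continuity on the torus\<close>

lemma periodic_int:
  assumes "on_torus g"
  shows "g (x + of_int i, y + of_int j) = g (x, y)"
proof -
  have "g (x + of_nat k, y) = g (x, y)" for k x y
    by (induction k) (use assms in \<open>auto simp: on_torus_def add.assoc[symmetric] add.commute[of 1]\<close>)
  then have x: "g (x + of_int i, y) = g (x, y)" for i x y
    by (cases i rule: int_cases2) (metis of_int_of_nat_eq, metis add.commute add_minus_cancel of_int_minus of_int_of_nat_eq)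
  have "g (x, y + of_nat k) = g (x, y)" for k x y
    by (induction k) (use assms in \<open>auto simp: on_torus_def add.assoc[symmetric] add.commute[of 1]\<close>)
  then have "g (x, y + of_int i) = g (x, y)" for i x y
    by (cases i rule: int_cases2) (metis of_int_of_nat_eq, metis add.commute add_minus_cancel of_int_minus of_int_of_nat_eq)
  with x show ?thesis by simp
qed

text \<open>Heine-Cantor on the compact set of times in [-1, 1] and points of the unit square;
  fractional parts move any point into the square without changing the values. The bound
  \<open>min d 1\<close> on t keeps the time inside [-1, 1].\<close>

lemma continuous_family_uniform:
  assumes g: "continuous_family g" and e: "e > 0"
  obtains \<delta> where "\<delta> > 0" "\<And>t p. \<bar>t\<bar> < \<delta> \<Longrightarrow> dist (g t p) (g 0 p) < e"
proof -
  define K where "K = cbox (-1) (1::real) \<times> (cbox 0 (1::real) \<times> cbox 0 (1::real))"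
  have "compact K" unfolding K_def by (intro compact_Times compact_cbox)
  moreover have "continuous_on K (\<lambda>(t, p). g t p)"
    using g by (auto simp: continuous_family_def intro: continuous_on_subset)
  ultimately have "uniformly_continuous_on K (\<lambda>(t, p). g t p)"
    by (rule compact_uniformly_continuous[rotated])
  then obtain d where d: "d > 0"
    "\<And>z w. z \<in> K \<Longrightarrow> w \<in> K \<Longrightarrow> dist w z < d \<Longrightarrow> dist (case w of (t, p) \<Rightarrow> g t p) (case z of (t, p) \<Rightarrow> g t p) < e"
    unfolding uniformly_continuous_on_def using e by metis
  have "dist (g t (x, y)) (g 0 (x, y)) < e" if t: "\<bar>t\<bar> < min d 1" for t x y
  proof -
    have fr: "g t (x, y) = g t (frac x, frac y)" for t
      using periodic_int[of "g t" "frac x" "\<lfloor>x\<rfloor>" "frac y" "\<lfloor>y\<rfloor>"] g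
      by (simp add: continuous_family_def frac_def)
    have "frac x \<le> 1" "frac y \<le> 1" using frac_lt_1 less_imp_le by blast+
    then have "(t, frac x, frac y) \<in> K" "(0, frac x, frac y) \<in> K" using t by (auto simp: K_def)
    moreover have "dist (t, frac x, frac y) (0, frac x, frac y) < d"
      using t by (simp add: dist_Pair_Pair)
    ultimately show ?thesis using d(2) fr by fastforce
  qed
  with that[of "min d 1"] d(1) show thesis by auto
qed

section \<open>Foliated 1-forms\<close>

lemma foliated_class_eq:
  assumes g: "smooth_torus g" and f: "f = X \<alpha> g"
  shows "foliated_class \<alpha> (times_dx f) = foliated_class \<alpha> (dif g)"
proof -
  \<comment> \<open>A foliated class depends only on the values on the leaf direction (1, \<alpha>).
    There dx takes the value 1 and dg takes the value X g.\<close>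
  have "times_dx f p (1, \<alpha>) = dif g p (1, \<alpha>)" for p
    using X_eq[OF smooth_differentiable, of g \<alpha> p] g f by (simp add: times_dx_def dif_def smooth_torus_def)
  then show ?thesis by (simp add: foliated_class_def vanishes_along_leaves_def)
qed

lemma smooth_form_times_dx:
  assumes "smooth_torus f"
  shows "smooth_form (times_dx f)"
  unfolding smooth_form_def
proof (intro conjI allI)
  show "linear (times_dx f p)" for p
    by (rule linearI) (simp_all add: times_dx_def distrib_left scaleR_conv_of_real)
  show "smooth_torus (\<lambda>p. times_dx f p v)" for v
    using assms smooth_mult_const[of f] by (simp add: smooth_torus_def times_dx_def on_torus_def)
qed

text \<open>The form f dx is smooth, hence lies in its own class and so in that of dg; evaluating
  the difference on (1, \<alpha>) at time 0 of the orbit of p gives the equation at p.\<close>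

lemma foliated_class_eqD:
  assumes f: "smooth_torus f" and g: "smooth_torus g"
    and eq: "foliated_class \<alpha> (times_dx f) = foliated_class \<alpha> (dif g)"
  shows "f = X \<alpha> g"
proof
  fix p
  have "times_dx f \<in> foliated_class \<alpha> (times_dx f)"
    using smooth_form_times_dx[OF f] by (simp add: foliated_class_def vanishes_along_leaves_def)
  then have "times_dx f (orbit \<alpha> p 0) (1, \<alpha>) - dif g (orbit \<alpha> p 0) (1, \<alpha>) = 0"
    unfolding eq by (simp add: foliated_class_def vanishes_along_leaves_def del: split_paired_All)
  then show "f p = X \<alpha> g p"
    using X_eq[OF smooth_differentiable, of g \<alpha> p] g
    by (simp add: times_dx_def orbit_def dif_def smooth_torus_def flip: zero_prod_def)
qed

lemma smooth_foliated_family_times_dx: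
  assumes "smooth_family f"
  shows "smooth_foliated_family \<alpha> (\<lambda>t. foliated_class \<alpha> (times_dx (f t)))"
  unfolding smooth_foliated_family_def
proof (intro exI conjI allI)
  show "smooth_form (times_dx (f t))" for t
    by (intro smooth_form_times_dx smooth_family_torus assms)
  show "smooth_family (\<lambda>t p. times_dx (f t) p v)" for v
    using assms smooth_mult_const[of "\<lambda>(t, p). f t p"]
    by (simp add: smooth_family_def times_dx_def on_torus_def case_prod_unfold)
qed simp

section \<open>Solvability for each t and the obstruction to continuity\<close>

context small_denominators
begin

lemma X_primitive: "source t = X \<alpha> (primitive t)"
proof
  fix p :: "real \<times> real"
  obtain x y where p: "p = (x, y)" by (cases p)
  note rap = rapid_cmult rapid_n rapid_m rapid_bump
  \<comment> \<open>Along this inclusion the t-component of the direction is 0, so the first two of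
    the four series in \<open>series_has_derivative\<close> vanish.\<close>
  have "((\<lambda>p. (0::real, p)) has_derivative (\<lambda>v. (0, v))) (at p)"
    by (auto intro!: derivative_eq_intros)
  from has_derivative_compose[OF this series_has_derivative[OF rapid_bump, of t 0 "(0, p)"]]
  have D: "(primitive t has_derivative (\<lambda>h.
     series (\<lambda>j. 2 * pi * \<i> * of_real (snd h) * (of_int (n j) * bump t j)) 0 (0, p) +
     series (\<lambda>j. - 2 * pi * \<i> * of_real (fst h) * (of_int (m j) * bump t j)) 0 (0, p))) (at p)"
    by (simp add: primitive_def[abs_def] series_def)
  have "X \<alpha> (primitive t) p =
     series (\<lambda>j. 2 * pi * \<i> * of_real \<alpha> * (of_int (n j) * bump t j)) 0 (0, p) +
     series (\<lambda>j. - 2 * pi * \<i> * of_real 1 * (of_int (m j) * bump t j)) 0 (0, p)"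
    using D by (subst X_eq) (auto simp: differentiable_def simp flip: frechet_derivative_at[OF D])
  also have "\<dots> = (\<Sum>j. 2 * pi * \<i> * of_real \<alpha> * (of_int (n j) * bump t j) * of_real (fst (0::real, p) ^ 0) * mode j (0, p) +
      (- 2 * pi * \<i> * of_real 1 * (of_int (m j) * bump t j) * of_real (fst (0::real, p) ^ 0) * mode j (0, p)))"
    unfolding series_def by (intro suminf_add series_summable rap)
  also have "\<dots> = source t p"
    unfolding source_def series_def
  proof (intro suminf_cong)
    fix j
    \<comment> \<open>The exponential in \<open>bump t j\<close> moves into the mode, changing its
      time argument from 0 to t.\<close>
    have *: "bump t j * mode j (0, p) = of_real (of_int (n j) * t) * mode j (t, p)"
      by (simp only: bump_def mode_def p prod.case exp_add exp_of_real) simp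
    have "2 * pi * \<i> * of_real \<alpha> * (of_int (n j) * bump t j) * of_real (fst (0::real, p) ^ 0) * mode j (0, p) +
        (- 2 * pi * \<i> * of_real 1 * (of_int (m j) * bump t j) * of_real (fst (0::real, p) ^ 0) * mode j (0, p)) =
      2 * pi * \<i> * of_real (gap j) * (bump t j * mode j (0, p))"
      by (simp add: gap_def algebra_simps)
    then show "2 * pi * \<i> * of_real \<alpha> * (of_int (n j) * bump t j) * of_real (fst (0::real, p) ^ 0) * mode j (0, p) +
        (- 2 * pi * \<i> * of_real 1 * (of_int (m j) * bump t j) * of_real (fst (0::real, p) ^ 0) * mode j (0, p)) =
      2 * pi * \<i> * of_real (gap j * of_int (n j)) * of_real (fst (t, p) ^ 1) * mode j (t, p)"
      unfolding * by simp
  qed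
  finally show "source t p = X \<alpha> (primitive t) p" by simp
qed

lemma primitive_oscillation:
  fixes t :: real
  assumes t: "t \<ge> 0"
  shows "n k * t * exp (- (n k * t\<^sup>2)) * (1 - cos (2 * pi * gap k * s)) \<le> Re (primitive t 0 - primitive t (s *\<^sub>R (1, \<alpha>)))"
proof -
  define a where "a j = n j * t * exp (- (n j * t\<^sup>2)) * (1 - cos (2 * pi * gap j * s))" for j
  have S: "(\<lambda>j. bump t j * mode j (0, p)) sums primitive t p" for p
    using summable_sums[OF series_summable[OF rapid_bump, of t "(0, p)" 0]]
    by (simp add: primitive_def series_def)
  have "(\<lambda>j. Re (bump t j * mode j (0, 0) - bump t j * mode j (0, s *\<^sub>R (1, \<alpha>)))) sums
      Re (primitive t 0 - primitive t (s *\<^sub>R (1, \<alpha>)))"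
    by (intro sums_Re sums_diff S)
  \<comment> \<open>At s (1, \<alpha>) the phase of the j-th mode is 2 pi (n_j \<alpha> s - m_j s) =
    2 pi gap_j s.\<close>
  moreover have "Re (bump t j * mode j (0, 0) - bump t j * mode j (0, s *\<^sub>R (1, \<alpha>))) = a j" for j
    by (simp add: a_def bump_def mode_def gap_def zero_prod_def Re_exp algebra_simps)
  ultimately have "a sums Re (primitive t 0 - primitive t (s *\<^sub>R (1, \<alpha>)))" by simp
  moreover have "a j \<ge> 0" for j
    using t n_ge_1[of j] by (auto simp: a_def intro!: mult_nonneg_nonneg)
  ultimately have "a k \<le> Re (primitive t 0 - primitive t (s *\<^sub>R (1, \<alpha>)))"
    using sum_le_suminf[of a "{k}"] by (auto simp: sums_iff)
  then show ?thesis by (simp add: a_def)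
qed

lemma no_continuous_primitive:
  assumes cont: "continuous_family g" and smooth: "\<And>t. smooth_torus (g t)"
    and g: "\<And>t. source t = X \<alpha> (g t)"
  shows False
proof -
  obtain \<delta> where \<delta>: "\<delta> > 0" "\<And>t p. \<bar>t\<bar> < \<delta> \<Longrightarrow> dist (g t p) (g 0 p) < 1/4"
    using continuous_family_uniform[OF cont, of "1/4"] by auto
  obtain k :: nat where k: "1 / \<delta> < real k" using reals_Archimedean2 by blast
  \<comment> \<open>At this time n_k t = 1 and n_k t^2 = t, so the k-th coefficient is exp (- t).
    The point q below is reached at s = 1 / (2 gap_k), where the phase is pi and 1 - cos equals 2; s
    is negative if the gap is.\<close>
  define t where "t = 1 / real_of_int (n k)"
  define q where "q = (1 / (2 * gap k)) *\<^sub>R (1::real, \<alpha>)"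
  have "1 / \<delta> < n k" using k n_ge[of k] by linarith
  then have t: "t > 0" "\<bar>t\<bar> < \<delta>"
    using \<delta>(1) n_ge_1[of k] by (auto simp: t_def field_simps)
  have diff: "g t q - primitive t q = g t 0 - primitive t 0" for t
    unfolding q_def using smooth primitive_torus X_primitive g
    by (intro X_eq_imp_diff_constant smooth_differentiable) (auto simp: smooth_torus_def)
  have "primitive 0 p = 0" for p by (simp add: primitive_def series_def bump_def)
  then have g0: "g 0 q = g 0 0" using diff[of 0] by simp
  \<comment> \<open>Since \<open>primitive 0\<close> vanishes, g_0 agrees at 0 and q. The
    oscillation thus becomes a difference of two increments in time, each below 1/4; as q varies
    with k, this relies on \<delta> being uniform in the point.\<close>
  have "primitive t 0 - primitive t q = (g t 0 - g 0 0) - (g t q - g 0 q)"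
    using diff[of t] g0 by (simp add: algebra_simps)
  then have "norm (primitive t 0 - primitive t q) = norm ((g t 0 - g 0 0) - (g t q - g 0 q))"
    by simp
  also have "\<dots> \<le> norm (g t 0 - g 0 0) + norm (g t q - g 0 q)" by (rule norm_triangle_ineq4)
  also have "\<dots> < 1/4 + 1/4"
    using \<delta>(2)[OF t(2)] by (intro add_strict_mono) (auto simp: dist_norm)
  finally have "Re (primitive t 0 - primitive t q) < 1/2"
    using complex_Re_le_cmod[of "primitive t 0 - primitive t q"] by linarith
  moreover have "n k * t * exp (- (n k * t\<^sup>2)) * (1 - cos (2 * pi * gap k * (1 / (2 * gap k)))) = 2 * exp (- t)"
    using gap_nonzero[of k] n_ge_1[of k] by (simp add: t_def power2_eq_square)
  ultimately have "2 * exp (- t) < 1/2"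
    using primitive_oscillation[of t k "1 / (2 * gap k)"] t by (simp add: q_def)
  \<comment> \<open>From t \<le> 1 and e \<le> 3 follows 2 exp (- t) > 1/2, the value that two
    increments of 1/4 cannot reach.\<close>
  moreover have "exp t \<le> exp 1" using n_ge_1[of k] by (simp add: t_def)
  then have "exp t < 4" using exp_le by linarith
  then have "1/4 < exp (- t)" by (simp add: exp_minus inverse_eq_divide less_divide_eq)
  ultimately show False by linarith
qed

end

section \<open>Conclusion for Liouville numbers\<close>

lemma Liouville_small_denominators:
  assumes "Liouville \<alpha>"
  obtains m n where "small_denominators \<alpha> m n"
proof -
  have "\<forall>k. \<exists>m n. n > int k \<and> real_of_int n * \<alpha> \<noteq> real_of_int m \<and>
      \<bar>real_of_int n * \<alpha> - real_of_int m\<bar> < 1 / real_of_int n ^ k"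
  proof
    fix k
    show "\<exists>m n. n > int k \<and> real_of_int n * \<alpha> \<noteq> real_of_int m \<and>
      \<bar>real_of_int n * \<alpha> - real_of_int m\<bar> < 1 / real_of_int n ^ k"
      by (rule Liouville_approximation[OF assms, of k]) (intro exI conjI)
  qed
  then obtain m n where "\<forall>k. n k > int k \<and> real_of_int (n k) * \<alpha> \<noteq> real_of_int (m k) \<and>
      \<bar>real_of_int (n k) * \<alpha> - real_of_int (m k)\<bar> < 1 / real_of_int (n k) ^ k"
    by (auto simp only: choice_iff)
  then show thesis
    by (intro that[of m n]) (simp add: small_denominators_def)
qed

theorem mainTheorem3:
  fixes \<alpha> :: real
  assumes "Liouville \<alpha>"
  shows "\<exists>f :: real \<Rightarrow> real \<times> real \<Rightarrow> complex.
    (smooth_family f \<and>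
     (\<forall>t. \<exists>g. smooth_torus g \<and> f t = X \<alpha> g) \<and>
     \<not> (\<exists>g. smooth_family g \<and> (\<forall>t. f t = X \<alpha> (g t))) \<and>
     \<not> (\<exists>g. continuous_family g \<and> (\<forall>t. smooth_torus (g t)) \<and> (\<forall>t. f t = X \<alpha> (g t)))) \<and>
    (smooth_foliated_family \<alpha> (\<lambda>t. foliated_class \<alpha> (times_dx (f t))) \<and>
     (\<forall>t. exact_foliated \<alpha> (foliated_class \<alpha> (times_dx (f t)))) \<and>
     \<not> (\<exists>g. smooth_family g \<and>
           (\<forall>t. foliated_class \<alpha> (times_dx (f t)) = foliated_class \<alpha> (dif (g t)))) \<and>
     \<not> (\<exists>g. continuous_family g \<and> (\<forall>t. smooth_torus (g t)) \<and>
           (\<forall>t. foliated_class \<alpha> (times_dx (f t)) = foliated_class \<alpha> (dif (g t)))))"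
proof -
  obtain m n where "small_denominators \<alpha> m n"
    using Liouville_small_denominators[OF assms] .
  then interpret small_denominators \<alpha> m n .
  have X: "smooth_torus (source t)" "smooth_torus (primitive t)" "source t = X \<alpha> (primitive t)" for t
    by (rule smooth_family_torus[OF source_family] primitive_torus X_primitive)+
  \<comment> \<open>This fact and the next also exclude smooth families, which are continuous
    families of smooth functions.\<close>
  have 1: False if "continuous_family g" "\<And>t. smooth_torus (g t)" "\<And>t. source t = X \<alpha> (g t)" for g
    using no_continuous_primitive that by blast
  have 2: False if "continuous_family g" "\<And>t. smooth_torus (g t)"
      "\<And>t. foliated_class \<alpha> (times_dx (source t)) = foliated_class \<alpha> (dif (g t))" for g
    using 1[of g] foliated_class_eqD[OF X(1)] that by blast
  have "\<exists>g. smooth_torus g \<and> source t = X \<alpha> g" for t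
    using X by blast
  moreover have "exact_foliated \<alpha> (foliated_class \<alpha> (times_dx (source t)))" for t
    unfolding exact_foliated_def using X foliated_class_eq by blast
  ultimately show ?thesis
    using source_family smooth_foliated_family_times_dx[OF source_family] 1 2
      smooth_family_continuous smooth_family_torus
    by (intro exI[of _ source]) blast
qed

end
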